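(* For every while-program $S\in WP$, each of the formulas $\alpha_S(\vec x,\vec y)$ and $\varphi_S(\vec x,y,\vec z)$ is, in $PA$, logically equivalent to a $\Sigma_1$-formula.
   Context: **Language.** $L$ is the first-order language with equality and signature $\{+,\cdot,<,0,1\}$ of Peano arithmetic $PA$. A $\Delta_0$-formula is built from atomic formulas using negation, conjunction, disjunction and bounded quantifiers $\forall x<t$, $\exists x<t$ ($t$ a term); a $\Sigma_1$-formula is one of the form $\exists x\,F$ with $F$ a $\Delta_0$-formula. Operations and relations on vectors are componentwise. **Coding functions (definable in $PA$ by $\Delta_0$-formulas).** $\langle x,y\rangle=\lfloor (x+y+1)(x+y)/2\rfloor+y$, and $L(z),R(z)$ are its inverses: $L(\langle x,y\rangle)=x$, $R(\langle x,y\rangle)=y$, $\langle L(z),R(z)\rangle=z$. Put $\langle x_1,\dots,x_n\rangle=\langle x_1,\langle x_2,\dots,x_n\rangle\rangle$, and let $\overline z$ be the $n$-tuple coded by $z$ ($\overline z=z$ if $n=1$). The extended $\beta$-function $(x)_i$ is the remainder of $L(x)$ on division by $R(x)\cdot(i+1)+1$. **While-programs.** Expressions $E::=0\mid1\mid x\mid E_1+E_2\mid E_1\cdot E_2$; boolean expressions $B::=E_1<E_2\mid\neg B_1\mid B_1\to B_2$; programs $S::=x:=E\mid S_1;S_2\mid if\ B\ then\ S_1\ else\ S_2\ fi\mid while\ B\ do\ S_0\ od$. $WP$ is the set of all programs. $\vec x=(x_1,\dots,x_n)$ lists the program variables of $S$ (the formulas for subprograms of $S$ use the same vector $\vec x$).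 **Formulas.** For $\vec y=(y_1,\dots,y_n)$ disjoint from $\vec x$ define $\alpha_S(\vec x,\vec y)\in L$ by: for $x_i:=E$, $y_i=E(\vec x)\wedge\bigwedge_{j\ne i}y_j=x_j$; for $S_1;S_2$, $\exists\vec z(\alpha_{S_1}(\vec x,\vec z)\wedge\alpha_{S_2}(\vec z,\vec y))$; for $if\ B\ then\ S_1\ else\ S_2\ fi$, $(B(\vec x)\wedge\alpha_{S_1}(\vec x,\vec y))\vee(\neg B(\vec x)\wedge\alpha_{S_2}(\vec x,\vec y))$; for $S\equiv while\ B\ do\ S_0\ od$, $\exists i\,\alpha^*_S(i,\vec x,\vec y)\wedge\neg B(\vec y)$, where $\alpha_S^*(i,\vec x,\vec y)::=\exists w\big(\vec x=\overline{(w)_0}\wedge\forall j<i\,(B(\overline{(w)_j})\wedge\alpha_{S_0}(\overline{(w)_j},\overline{(w)_{j+1}}))\wedge\vec y=\overline{(w)_i}\big)$. For any program $S$, $\varphi_{S}(\vec x,y,\vec z)::=\exists w\big(\overline{(w)_0}=\vec x\wedge\forall j<y\ \alpha_{S}(\overline{(w)_j},\overline{(w)_{j+1}})\wedge\overline{(w)_y}=\vec z\big)$. *)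

theory Defs
  imports Main
begin

section \<open>The language of Peano arithmetic\<close>

text \<open>Variables are de Bruijn indices: under \<open>Forall\<close> and \<open>Exists\<close>, \<open>Var 0\<close> is the bound variable and
  \<open>Var (Suc i)\<close> stands for the variable \<open>i\<close> of the surrounding context.\<close>

datatype tm = Var nat | Zero | One | Add tm tm | Mul tm tm

datatype fm = Eq tm tm | Lt tm tm | Neg fm | Conj fm fm | Disj fm fm | Forall fm | Exists fm

abbreviation Imp :: "fm \<Rightarrow> fm \<Rightarrow> fm" where
  "Imp F G \<equiv> Disj (Neg F) G"

abbreviation Iff :: "fm \<Rightarrow> fm \<Rightarrow> fm" where
  "Iff F G \<equiv> Conj (Imp F G) (Imp G F)"

primrec subst_tm :: "(nat \<Rightarrow> tm) \<Rightarrow> tm \<Rightarrow> tm" where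
  "subst_tm \<sigma> (Var i) = \<sigma> i"
| "subst_tm \<sigma> Zero = Zero"
| "subst_tm \<sigma> One = One"
| "subst_tm \<sigma> (Add s t) = Add (subst_tm \<sigma> s) (subst_tm \<sigma> t)"
| "subst_tm \<sigma> (Mul s t) = Mul (subst_tm \<sigma> s) (subst_tm \<sigma> t)"

text \<open>\<open>lift k t\<close> is \<open>t\<close> read under \<open>k\<close> further quantifiers.\<close>

definition lift :: "nat \<Rightarrow> tm \<Rightarrow> tm" where
  "lift k = subst_tm (\<lambda>i. Var (i + k))"

definition up :: "(nat \<Rightarrow> tm) \<Rightarrow> nat \<Rightarrow> tm" where
  "up \<sigma> = case_nat (Var 0) (\<lambda>i. lift 1 (\<sigma> i))"

primrec subst :: "(nat \<Rightarrow> tm) \<Rightarrow> fm \<Rightarrow> fm" where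
  "subst \<sigma> (Eq s t) = Eq (subst_tm \<sigma> s) (subst_tm \<sigma> t)"
| "subst \<sigma> (Lt s t) = Lt (subst_tm \<sigma> s) (subst_tm \<sigma> t)"
| "subst \<sigma> (Neg F) = Neg (subst \<sigma> F)"
| "subst \<sigma> (Conj F G) = Conj (subst \<sigma> F) (subst \<sigma> G)"
| "subst \<sigma> (Disj F G) = Disj (subst \<sigma> F) (subst \<sigma> G)"
| "subst \<sigma> (Forall F) = Forall (subst (up \<sigma>) F)"
| "subst \<sigma> (Exists F) = Exists (subst (up \<sigma>) F)"

definition shift :: "fm \<Rightarrow> fm" where
  "shift = subst (\<lambda>i. Var (Suc i))"

text \<open>\<open>inst t F\<close> instantiates the outermost bound variable of \<open>Forall F\<close> or \<open>Exists F\<close> by \<open>t\<close>.\<close>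

definition inst :: "tm \<Rightarrow> fm \<Rightarrow> fm" where
  "inst t = subst (case_nat t Var)"

definition BAll :: "tm \<Rightarrow> fm \<Rightarrow> fm" where
  "BAll t F = Forall (Imp (Lt (Var 0) (lift 1 t)) F)"

definition BEx :: "tm \<Rightarrow> fm \<Rightarrow> fm" where
  "BEx t F = Exists (Conj (Lt (Var 0) (lift 1 t)) F)"

inductive delta0 :: "fm \<Rightarrow> bool" where
  "delta0 (Eq s t)"
| "delta0 (Lt s t)"
| "delta0 F \<Longrightarrow> delta0 (Neg F)"
| "delta0 F \<Longrightarrow> delta0 G \<Longrightarrow> delta0 (Conj F G)"
| "delta0 F \<Longrightarrow> delta0 G \<Longrightarrow> delta0 (Disj F G)"
| "delta0 F \<Longrightarrow> delta0 (BAll t F)"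
| "delta0 F \<Longrightarrow> delta0 (BEx t F)"

definition sigma1 :: "fm \<Rightarrow> bool" where
  "sigma1 G \<longleftrightarrow> (\<exists>F. delta0 F \<and> G = Exists F)"


section \<open>Provability in Peano arithmetic\<close>

text \<open>Classical natural deduction with equality. The axioms in \<open>T\<close> may have free variables and
  then stand for their universal closures: in \<open>Forall_intro\<close> and \<open>Exists_elim\<close> only the
  hypotheses \<open>\<Gamma>\<close> are shifted.\<close>

inductive proves :: "fm set \<Rightarrow> fm list \<Rightarrow> fm \<Rightarrow> bool" for T :: "fm set" where
  axiom: "F \<in> T \<Longrightarrow> proves T \<Gamma> F"
| assum: "F \<in> set \<Gamma> \<Longrightarrow> proves T \<Gamma> F"
| Neg_intro: "proves T (F # \<Gamma>) G \<Longrightarrow> proves T (F # \<Gamma>) (Neg G) \<Longrightarrow> proves T \<Gamma> (Neg F)"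
| Neg_classical: "proves T (Neg F # \<Gamma>) G \<Longrightarrow> proves T (Neg F # \<Gamma>) (Neg G) \<Longrightarrow> proves T \<Gamma> F"
| Conj_intro: "proves T \<Gamma> F \<Longrightarrow> proves T \<Gamma> G \<Longrightarrow> proves T \<Gamma> (Conj F G)"
| Conj_elim1: "proves T \<Gamma> (Conj F G) \<Longrightarrow> proves T \<Gamma> F"
| Conj_elim2: "proves T \<Gamma> (Conj F G) \<Longrightarrow> proves T \<Gamma> G"
| Disj_intro1: "proves T \<Gamma> F \<Longrightarrow> proves T \<Gamma> (Disj F G)"
| Disj_intro2: "proves T \<Gamma> G \<Longrightarrow> proves T \<Gamma> (Disj F G)"
| Disj_elim: "proves T \<Gamma> (Disj F G) \<Longrightarrow> proves T (F # \<Gamma>) H \<Longrightarrow> proves T (G # \<Gamma>) H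
    \<Longrightarrow> proves T \<Gamma> H"
| Forall_intro: "proves T (map shift \<Gamma>) F \<Longrightarrow> proves T \<Gamma> (Forall F)"
| Forall_elim: "proves T \<Gamma> (Forall F) \<Longrightarrow> proves T \<Gamma> (inst t F)"
| Exists_intro: "proves T \<Gamma> (inst t F) \<Longrightarrow> proves T \<Gamma> (Exists F)"
| Exists_elim: "proves T \<Gamma> (Exists F) \<Longrightarrow> proves T (F # map shift \<Gamma>) (shift G) \<Longrightarrow> proves T \<Gamma> G"
| Eq_refl: "proves T \<Gamma> (Eq t t)"
| Eq_subst: "proves T \<Gamma> (Eq s t) \<Longrightarrow> proves T \<Gamma> (inst s F) \<Longrightarrow> proves T \<Gamma> (inst t F)"

text \<open>In \<open>induction\<close> the formula \<open>F\<close> is arbitrary, with induction variable \<open>Var 0\<close> and all other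
  variables as parameters.\<close>

inductive_set PA :: "fm set" where
  succ_nonzero: "Neg (Eq (Add (Var 0) One) Zero) \<in> PA"
| succ_inj: "Imp (Eq (Add (Var 0) One) (Add (Var 1) One)) (Eq (Var 0) (Var 1)) \<in> PA"
| plus_zero: "Eq (Add (Var 0) Zero) (Var 0) \<in> PA"
| plus_succ: "Eq (Add (Var 0) (Add (Var 1) One)) (Add (Add (Var 0) (Var 1)) One) \<in> PA"
| times_zero: "Eq (Mul (Var 0) Zero) Zero \<in> PA"
| times_succ: "Eq (Mul (Var 0) (Add (Var 1) One)) (Add (Mul (Var 0) (Var 1)) (Var 0)) \<in> PA"
| not_less_Zero: "Neg (Lt (Var 0) Zero) \<in> PA"
| less_succ: "Iff (Lt (Var 0) (Add (Var 1) One)) (Disj (Lt (Var 0) (Var 1)) (Eq (Var 0) (Var 1)))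
    \<in> PA"
| induction: "Imp (Conj (inst Zero F)
                  (Forall (Imp F (subst (case_nat (Add (Var 0) One) (\<lambda>i. Var (Suc i))) F))))
            (Forall F) \<in> PA"

definition PA_equiv :: "fm \<Rightarrow> fm \<Rightarrow> bool" where
  "PA_equiv F G \<longleftrightarrow> proves PA [] (Iff F G)"


section \<open>Coding functions\<close>

text \<open>The coding functions are given by \<open>\<Delta>\<^sub>0\<close>-definitions of their graphs.\<close>

text \<open>\<open>pair_fm x y z\<close>: \<open>z = \<langle>x,y\<rangle>\<close>, with \<open>Var 0\<close> the value \<open>\<lfloor>(x+y+1)(x+y)/2\<rfloor>\<close>.\<close>

definition pair_fm :: "tm \<Rightarrow> tm \<Rightarrow> tm \<Rightarrow> fm" where
  "pair_fm x y z = BEx (Add z One)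
     (let p = Mul (Add (Add (lift 1 x) (lift 1 y)) One) (Add (lift 1 x) (lift 1 y));
          d = Add (Var 0) (Var 0)
      in Conj (Disj (Eq p d) (Eq p (Add d One))) (Eq (lift 1 z) (Add (Var 0) (lift 1 y))))"

text \<open>\<open>tuple_fm xs z\<close>: \<open>z\<close> is the code of the nonempty tuple \<open>xs\<close>, i.e. \<open>xs\<close> is the tuple coded
  by \<open>z\<close>. The value at the empty list is arbitrary.\<close>

fun tuple_fm :: "tm list \<Rightarrow> tm \<Rightarrow> fm" where
  "tuple_fm [] z = Eq z Zero"
| "tuple_fm [x] z = Eq z x"
| "tuple_fm (x # y # xs) z = BEx (Add z One)
     (Conj (pair_fm (lift 1 x) (Var 0) (lift 1 z)) (tuple_fm (map (lift 1) (y # xs)) (Var 0)))"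

text \<open>\<open>beta_fm w i r\<close>: \<open>r = (w)\<^sub>i\<close>, with \<open>a = L(w)\<close>, \<open>b = R(w)\<close> and quotient \<open>Var 0\<close>.\<close>

definition beta_fm :: "tm \<Rightarrow> tm \<Rightarrow> tm \<Rightarrow> fm" where
  "beta_fm w i r = BEx (Add w One) (BEx (Add (lift 1 w) One)
     (Conj (pair_fm (Var 1) (Var 0) (lift 2 w)) (BEx (Add (Var 1) One)
       (let a = Var 2; m = Add (Mul (Var 1) (Add (lift 3 i) One)) One
        in Conj (Lt (lift 3 r) m) (Eq a (Add (Mul (Var 0) m) (lift 3 r)))))))"

text \<open>\<open>seq_fm w i xs\<close>: \<open>xs\<close> is the tuple coded by \<open>(w)\<^sub>i\<close>.\<close>

definition seq_fm :: "tm \<Rightarrow> tm \<Rightarrow> tm list \<Rightarrow> fm" where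
  "seq_fm w i xs = BEx (Add w One)
     (Conj (beta_fm (lift 1 w) (lift 1 i) (Var 0)) (tuple_fm (map (lift 1) xs) (Var 0)))"


section \<open>While-programs and their formulas\<close>

text \<open>Expressions have the same grammar as terms; the program variable \<open>x\<close> is \<open>Var x\<close>.\<close>

datatype bexp = BLess tm tm | BNot bexp | BImp bexp bexp

datatype prog = Assign nat tm | Seq prog prog | Cond bexp prog prog | While bexp prog

primrec tm_vars :: "tm \<Rightarrow> nat set" where
  "tm_vars (Var x) = {x}"
| "tm_vars Zero = {}"
| "tm_vars One = {}"
| "tm_vars (Add s t) = tm_vars s \<union> tm_vars t"
| "tm_vars (Mul s t) = tm_vars s \<union> tm_vars t"

primrec bexp_vars :: "bexp \<Rightarrow> nat set" where
  "bexp_vars (BLess s t) = tm_vars s \<union> tm_vars t"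
| "bexp_vars (BNot B) = bexp_vars B"
| "bexp_vars (BImp B C) = bexp_vars B \<union> bexp_vars C"

primrec prog_vars :: "prog \<Rightarrow> nat set" where
  "prog_vars (Assign x E) = insert x (tm_vars E)"
| "prog_vars (Seq S1 S2) = prog_vars S1 \<union> prog_vars S2"
| "prog_vars (Cond B S1 S2) = bexp_vars B \<union> prog_vars S1 \<union> prog_vars S2"
| "prog_vars (While B S) = bexp_vars B \<union> prog_vars S"

text \<open>\<open>val xs ts\<close> maps the program variable \<open>xs ! i\<close> to \<open>ts ! i\<close>; thus \<open>E(ts)\<close> is
  \<open>subst_tm (val xs ts) E\<close> and \<open>B(ts)\<close> is \<open>bexp_fm xs ts B\<close>.\<close>

definition val :: "nat list \<Rightarrow> tm list \<Rightarrow> nat \<Rightarrow> tm" where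
  "val xs ts x = (case map_of (zip xs ts) x of Some t \<Rightarrow> t | None \<Rightarrow> Var x)"

primrec bexp_fm :: "nat list \<Rightarrow> tm list \<Rightarrow> bexp \<Rightarrow> fm" where
  "bexp_fm xs ts (BLess E1 E2) = Lt (subst_tm (val xs ts) E1) (subst_tm (val xs ts) E2)"
| "bexp_fm xs ts (BNot B) = Neg (bexp_fm xs ts B)"
| "bexp_fm xs ts (BImp B C) = Imp (bexp_fm xs ts B) (bexp_fm xs ts C)"

primrec conjs :: "fm \<Rightarrow> fm list \<Rightarrow> fm" where
  "conjs F [] = F"
| "conjs F (G # Gs) = Conj F (conjs G Gs)"

definition exs :: "nat \<Rightarrow> fm \<Rightarrow> fm" where
  "exs k = Exists ^^ k"

text \<open>\<open>iter_fm n step i ts us\<close> is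
  \<open>\<exists>w. ts = coded (w)\<^sub>0 \<and> (\<forall>j<i. step (coded (w)\<^sub>j) (coded (w)\<^sub>j\<^sub>+\<^sub>1)) \<and> us = coded (w)\<^sub>i\<close> for vectors of
  length \<open>n\<close>. The arguments of \<open>step\<close> are not terms of the language; as usual for defined
  functions, they are eliminated by \<open>2 * n\<close> existentially quantified variables: the vectors
  \<open>Var 0, \<dots>, Var (n - 1)\<close> and \<open>Var n, \<dots>, Var (2 * n - 1)\<close>. Inside, \<open>j\<close> is \<open>Var (2 * n)\<close> and
  \<open>w\<close> is \<open>Var (2 * n + 1)\<close>.\<close>

definition iter_fm ::
  "nat \<Rightarrow> (tm list \<Rightarrow> tm list \<Rightarrow> fm) \<Rightarrow> tm \<Rightarrow> tm list \<Rightarrow> tm list \<Rightarrow> fm" where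
  "iter_fm n step i ts us = Exists
     (Conj (seq_fm (Var 0) Zero (map (lift 1) ts))
     (Conj (BAll (lift 1 i)
        (let ps = map Var [0..<n]; qs = map Var [n..<2 * n]; j = Var (2 * n); w = Var (2 * n + 1)
         in exs (2 * n)
              (Conj (seq_fm w j ps) (Conj (seq_fm w (Add j One) qs) (step ps qs)))))
       (seq_fm (Var 0) (lift 1 i) (map (lift 1) us))))"

text \<open>\<open>alpha_fm xs S ts us\<close> is \<open>\<alpha>\<^sub>S(ts, us)\<close>, where \<open>xs\<close> is the vector of program variables.\<close>

primrec alpha_fm :: "nat list \<Rightarrow> prog \<Rightarrow> tm list \<Rightarrow> tm list \<Rightarrow> fm" where
  "alpha_fm xs (Assign x E) ts us =
     conjs (Eq (val xs us x) (subst_tm (val xs ts) E))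
       (map (\<lambda>v. Eq (val xs us v) (val xs ts v)) (filter (\<lambda>v. v \<noteq> x) xs))"
| "alpha_fm xs (Seq S1 S2) ts us =
     (let n = length xs; zs = map Var [0..<n]
      in exs n (Conj (alpha_fm xs S1 (map (lift n) ts) zs) (alpha_fm xs S2 zs (map (lift n) us))))"
| "alpha_fm xs (Cond B S1 S2) ts us =
     Disj (Conj (bexp_fm xs ts B) (alpha_fm xs S1 ts us))
          (Conj (Neg (bexp_fm xs ts B)) (alpha_fm xs S2 ts us))"
| "alpha_fm xs (While B S) ts us =
     Conj (Exists (iter_fm (length xs) (\<lambda>ps qs. Conj (bexp_fm xs ps B) (alpha_fm xs S ps qs))
                (Var 0) (map (lift 1) ts) (map (lift 1) us)))
          (Neg (bexp_fm xs us B))"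

text \<open>\<open>phi_fm xs S ts i us\<close> is \<open>\<phi>\<^sub>S(ts, i, us)\<close>.\<close>

definition phi_fm :: "nat list \<Rightarrow> prog \<Rightarrow> tm list \<Rightarrow> tm \<Rightarrow> tm list \<Rightarrow> fm" where
  "phi_fm xs S ts i us = iter_fm (length xs) (alpha_fm xs S) i ts us"

end

theory Submission
  imports Defs
begin

text \<open>The formulas equivalent to a \<open>\<Sigma>\<^sub>1\<close>-formula contain the \<open>\<Delta>\<^sub>0\<close>-formulas and are closed under
  conjunction, disjunction, existential quantification and bounded universal quantification. Two
  existential quantifiers are merged by bounding both witnesses by a common upper bound, so no pairing
  is needed; bounded universal quantifiers are handled by collection, which is proved by induction on
  the bound. The coding formulas are \<open>\<Delta>\<^sub>0\<close>, and negation is only applied to boolean expressions, so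
  the claim follows by induction on \<open>S\<close> for arbitrary argument terms. Whether the coding formulas
  mean what they should plays no role.\<close>

section \<open>Substitution\<close>

lemma subst_tm_Var [simp]: "subst_tm Var t = t"
  by (induction t) auto

lemma subst_tm_subst_tm: "subst_tm \<sigma> (subst_tm \<tau> t) = subst_tm (\<lambda>i. subst_tm \<sigma> (\<tau> i)) t"
  by (induction t) auto

text \<open>The default congruence rule keeps the simplifier out of the branches, and \<open>nat.case_cong\<close>
  makes it loop on the equation for the scrutinee.\<close>

lemma case_nat_cong [cong]:
  "i = j \<Longrightarrow> a = b \<Longrightarrow> (\<And>k. f k = g k) \<Longrightarrow> case_nat a f i = case_nat b g j"
  by (auto split: nat.split)

lemma subst_tm_case_nat:
  "subst_tm \<sigma> (case_nat t f i) = case_nat (subst_tm \<sigma> t) (\<lambda>j. subst_tm \<sigma> (f j)) i"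
  by (cases i) auto

text \<open>With \<open>subst_norm\<close> below, these equations bring renamings by at most four places into normal form.\<close>

lemma case_nat_Var [simp]:
  "case_nat (Var 0) (\<lambda>i. Var (Suc i)) = Var"
  "case_nat (Var (Suc 0)) (\<lambda>i. Var (Suc (Suc i))) = (\<lambda>i. Var (Suc i))"
  "case_nat (Var (Suc (Suc 0))) (\<lambda>i. Var (Suc (Suc (Suc i)))) = (\<lambda>i. Var (Suc (Suc i)))"
  "case_nat (Var (Suc (Suc (Suc 0)))) (\<lambda>i. Var (Suc (Suc (Suc (Suc i)))))
    = (\<lambda>i. Var (Suc (Suc (Suc i))))"
  "case_nat (Var (Suc (Suc (Suc (Suc 0))))) (\<lambda>i. Var (Suc (Suc (Suc (Suc (Suc i))))))
    = (\<lambda>i. Var (Suc (Suc (Suc (Suc i)))))"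
  by (auto simp: fun_eq_iff split: nat.split)

lemma subst_Var [simp]: "subst Var F = F"
  by (induction F) (auto simp: up_def lift_def)

lemma subst_subst: "subst \<sigma> (subst \<tau> F) = subst (\<lambda>i. subst_tm \<sigma> (\<tau> i)) F"
  by (induction F arbitrary: \<sigma> \<tau>)
    (simp_all add: up_def lift_def subst_tm_subst_tm subst_tm_case_nat)

text \<open>Collapses nested renamings and instances into one substitution with explicit
  \<open>Suc\<close> indices, so that syntactic side conditions become computations.\<close>

lemmas subst_norm = lift_def shift_def inst_def up_def subst_tm_subst_tm subst_subst
  subst_tm_case_nat numeral_eq_Suc

text \<open>The bound stands outside the scope of its quantifier, so lifting it commutes with
  \<open>up\<close>. Hence substitution keeps the shape of bounded quantifiers.\<close>

lemma subst_BAll: "subst \<sigma> (BAll t F) = BAll (subst_tm \<sigma> t) (subst (up \<sigma>) F)"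
  by (simp add: BAll_def subst_norm)

lemma subst_BEx: "subst \<sigma> (BEx t F) = BEx (subst_tm \<sigma> t) (subst (up \<sigma>) F)"
  by (simp add: BEx_def subst_norm)

lemma delta0_subst: "delta0 F \<Longrightarrow> delta0 (subst \<sigma> F)"
  by (induction arbitrary: \<sigma> rule: delta0.induct)
    (auto simp: subst_BAll subst_BEx intro: delta0.intros)


section \<open>Derived rules of natural deduction\<close>

text \<open>Comparing contexts as sets yields weakening, exchange and contraction at once; shifting
  both contexts preserves the inclusion.\<close>

lemma weaken: "proves T \<Gamma> F \<Longrightarrow> set \<Gamma> \<subseteq> set \<Delta> \<Longrightarrow> proves T \<Delta> F"
proof (induction arbitrary: \<Delta> rule: proves.induct)
  case (Neg_intro F \<Gamma> G)
  then show ?case by (intro proves.Neg_intro[of T F \<Delta> G]) (simp_all add: subset_insertI2)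
next
  case (Neg_classical F \<Gamma> G)
  then show ?case by (intro proves.Neg_classical[of T F \<Delta> G]) (simp_all add: subset_insertI2)
next
  case (Disj_elim \<Gamma> F G H)
  show ?case
    using Disj_elim.IH(1)[of \<Delta>] Disj_elim.IH(2)[of "F # \<Delta>"] Disj_elim.IH(3)[of "G # \<Delta>"]
      Disj_elim.prems
    by - (rule proves.Disj_elim[of T \<Delta> F G], auto)
next
  case (Forall_intro \<Gamma> F)
  show ?case
    by (rule proves.Forall_intro, rule Forall_intro.IH) (use Forall_intro.prems in auto)
next
  case (Exists_elim \<Gamma> F G)
  show ?case
    using Exists_elim.IH(1)[of \<Delta>] Exists_elim.IH(2)[of "F # map shift \<Delta>"] Exists_elim.prems
    by - (rule proves.Exists_elim[of T \<Delta> F], auto)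
next
  case (Conj_elim1 \<Gamma> F G)
  then show ?case by (metis proves.Conj_elim1)
next
  case (Conj_elim2 \<Gamma> F G)
  then show ?case by (metis proves.Conj_elim2)
next
  case (Eq_subst \<Gamma> s t F)
  then show ?case by (metis proves.Eq_subst)
next
  case (Exists_intro \<Gamma> t F)
  then show ?case by (metis proves.Exists_intro)
qed (simp_all add: axiom assum subsetD Conj_intro Disj_intro1 Disj_intro2 Forall_elim
    Eq_refl)

lemma exfalso: "proves T \<Gamma> F \<Longrightarrow> proves T \<Gamma> (Neg F) \<Longrightarrow> proves T \<Gamma> G"
  by (rule Neg_classical[where G = F]) (erule weaken, auto)+

text \<open>\<open>Imp\<close> is a disjunction, so this needs classical reasoning: the negated
  implication entails both \<open>F\<close> and \<open>Neg F\<close>, since either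
  \<open>Neg F\<close> or \<open>G\<close> would give the implication back.\<close>

lemma Imp_intro: "proves T (F # \<Gamma>) G \<Longrightarrow> proves T \<Gamma> (Imp F G)"
proof (rule Neg_classical[where G = F])
  let ?N = "Neg (Imp F G)"
  assume G: "proves T (F # \<Gamma>) G"
  have N: "proves T (H # ?N # \<Gamma>) ?N" for H
    by (rule assum) simp
  show "proves T (?N # \<Gamma>) F"
    by (rule Neg_classical[OF Disj_intro1[OF assum] N]) simp
  show "proves T (?N # \<Gamma>) (Neg F)"
    by (rule Neg_intro[OF Disj_intro2[OF weaken[OF G]] N]) auto
qed

lemma Imp_elim: "proves T \<Gamma> (Imp F G) \<Longrightarrow> proves T \<Gamma> F \<Longrightarrow> proves T \<Gamma> G"
  by (rule Disj_elim, assumption, rule exfalso[where F = F], erule weaken) (auto intro!: assum)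

lemma cut: "proves T \<Gamma> F \<Longrightarrow> proves T (F # \<Gamma>) G \<Longrightarrow> proves T \<Gamma> G"
  by (rule Imp_elim[OF Imp_intro])

text \<open>Derivations from a single hypothesis serve as an entailment relation below; this
  composes them.\<close>

lemma cut1: "proves T [F] G \<Longrightarrow> proves T \<Gamma> F \<Longrightarrow> proves T \<Gamma> G"
  by (rule cut, assumption, erule weaken) simp

text \<open>The instances appear through equations, so the pattern \<open>F\<close> can be given
  explicitly and its instances checked by simplification.\<close>

lemma Eq_substD:
  "proves T \<Gamma> (Eq s t) \<Longrightarrow> proves T \<Gamma> A \<Longrightarrow> inst s F = A \<Longrightarrow> inst t F = B \<Longrightarrow> proves T \<Gamma> B"
  using Eq_subst by blast

lemma Eq_sym: "proves T \<Gamma> (Eq s t) \<Longrightarrow> proves T \<Gamma> (Eq t s)"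
  by (erule Eq_substD[where F = "Eq (Var 0) (lift 1 s)"]) (auto simp: subst_norm intro: Eq_refl)

lemma Exists_introD: "proves T \<Gamma> A \<Longrightarrow> inst t F = A \<Longrightarrow> proves T \<Gamma> (Exists F)"
  using Exists_intro by blast

section \<open>Rules for bounded quantifiers\<close>

lemma BAll_intro: "proves T (Lt (Var 0) (lift 1 t) # map shift \<Gamma>) F \<Longrightarrow> proves T \<Gamma> (BAll t F)"
  unfolding BAll_def by (intro Forall_intro Imp_intro)

lemma BAll_elim:
  assumes "proves T \<Gamma> (BAll t F)" "proves T \<Gamma> (Lt s t)"
  shows "proves T \<Gamma> (inst s F)"
  using Forall_elim[OF assms(1)[unfolded BAll_def], of s] assms(2)
  by (auto simp: subst_norm intro: Imp_elim)

lemma BEx_intro: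
  assumes "proves T \<Gamma> (Lt s t)" "proves T \<Gamma> (inst s F)"
  shows "proves T \<Gamma> (BEx t F)"
  unfolding BEx_def
  by (rule Exists_introD[OF Conj_intro[OF assms]]) (simp add: subst_norm)

lemma BEx_elim:
  assumes "proves T \<Gamma> (BEx t F)"
    and "proves T (F # Lt (Var 0) (lift 1 t) # map shift \<Gamma>) (shift G)"
  shows "proves T \<Gamma> G"
proof (rule Exists_elim[OF assms(1)[unfolded BEx_def]])
  let ?L = "Lt (Var 0) (lift 1 t)"
  have C: "proves T (Conj ?L F # map shift \<Gamma>) (Conj ?L F)" by (rule assum) simp
  show "proves T (Conj ?L F # map shift \<Gamma>) (shift G)"
    by (rule cut[OF Conj_elim1[OF C] cut[OF weaken[OF Conj_elim2[OF C]] weaken[OF assms(2)]]]) auto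
qed


section \<open>The order in Peano arithmetic\<close>

text \<open>Axioms hold in every context, so they may be generalised twice; then \<open>t\<close> is
  put for \<open>Var 1\<close> and \<open>s\<close> for \<open>Var 0\<close>.\<close>

lemma axiom_inst:
  assumes "F \<in> PA"
  shows "proves PA \<Gamma> (subst (case_nat s (case_nat t Var)) F)"
proof -
  have "proves PA \<Gamma> (inst t (Forall F))"
    by (intro Forall_elim Forall_intro axiom assms)
  then have "proves PA \<Gamma> (Forall (subst (up (case_nat t Var)) F))"
    by (simp add: inst_def)
  from Forall_elim[OF this, of s] show ?thesis by (simp add: subst_norm)
qed

lemma induct_rule:
  assumes "proves PA \<Gamma> (inst Zero F)"
    and "proves PA (F # map shift \<Gamma>) (subst (case_nat (Add (Var 0) One) (\<lambda>i. Var (Suc i))) F)"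
  shows "proves PA \<Gamma> (inst t F)"
  by (rule Forall_elim[OF Imp_elim[OF axiom[OF PA.induction]]])
    (intro Conj_intro Forall_intro Imp_intro assms)

lemma less_succ_iff: "proves PA \<Gamma> (Iff (Lt s (Add t One)) (Disj (Lt s t) (Eq s t)))"
  using axiom_inst[OF PA.less_succ, of \<Gamma> s t] by simp

lemma less_succ_elim:
  "proves PA \<Gamma> (Lt s (Add t One)) \<Longrightarrow> proves PA (Lt s t # \<Gamma>) H \<Longrightarrow> proves PA (Eq s t # \<Gamma>) H
    \<Longrightarrow> proves PA \<Gamma> H"
  by (rule Disj_elim[OF Imp_elim[OF Conj_elim1[OF less_succ_iff]]])

lemma less_succ_self: "proves PA \<Gamma> (Lt s (Add s One))"
  by (rule Imp_elim[OF Conj_elim2[OF less_succ_iff]]) (intro Disj_intro2 Eq_refl)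

lemma less_succI: "proves PA \<Gamma> (Lt s t) \<Longrightarrow> proves PA \<Gamma> (Lt s (Add t One))"
  by (rule Imp_elim[OF Conj_elim2[OF less_succ_iff]]) (intro Disj_intro1)

lemma less_zero_elim: "proves PA \<Gamma> (Lt s Zero) \<Longrightarrow> proves PA \<Gamma> H"
  using axiom_inst[OF PA.not_less_Zero, of \<Gamma> s] by (auto intro: exfalso)

text \<open>Induction on \<open>t\<close>, with \<open>r < s\<close> kept as a hypothesis. If
  \<open>s < t + 1\<close>, then either \<open>s < t\<close>, where the induction hypothesis
  applies, or \<open>s = t\<close>, where \<open>r < s\<close> is rewritten.\<close>

lemma less_trans:
  assumes "proves PA \<Gamma> (Lt r s)" "proves PA \<Gamma> (Lt s t)"
  shows "proves PA \<Gamma> (Lt r t)"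
proof -
  let ?F = "Imp (Lt (lift 1 s) (Var 0)) (Lt (lift 1 r) (Var 0))"
  let ?s = "lift 1 s" and ?r = "lift 1 r"
  have "proves PA [Lt r s] (inst t ?F)"
  proof (rule induct_rule)
    show "proves PA [Lt r s] (inst Zero ?F)"
      by (simp add: subst_norm Imp_intro less_zero_elim[of _ s] assum)
    let ?G = "[Lt ?s (Add (Var 0) One), ?F, Lt ?r ?s]"
    have "proves PA ?G (Lt ?r (Add (Var 0) One))"
    proof (rule less_succ_elim[of _ ?s "Var 0"])
      show "proves PA (Lt ?s (Var 0) # ?G) (Lt ?r (Add (Var 0) One))"
        by (rule less_succI, rule Imp_elim[of _ _ "Lt ?s (Var 0)"]) (auto intro: assum)
      show "proves PA (Eq ?s (Var 0) # ?G) (Lt ?r (Add (Var 0) One))"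
        by (rule less_succI, rule Eq_substD[of _ _ ?s "Var 0" "Lt ?r ?s" "Lt (lift 1 ?r) (Var 0)"])
          (auto intro: assum simp: subst_norm)
    qed (auto intro: assum)
    then show "proves PA (?F # map shift [Lt r s])
        (subst (case_nat (Add (Var 0) One) (\<lambda>i. Var (Suc i))) ?F)"
      by (auto intro!: Imp_intro simp: subst_norm)
  qed
  then have "proves PA [Lt r s] (Imp (Lt s t) (Lt r t))" by (simp add: subst_norm)
  then show ?thesis by (rule Imp_elim[OF cut1[OF _ assms(1)] assms(2)])
qed

lemma succ_mono:
  assumes "proves PA \<Gamma> (Lt s t)"
  shows "proves PA \<Gamma> (Lt (Add s One) (Add t One))"
proof -
  let ?F = "Imp (Lt (lift 1 s) (Var 0)) (Lt (Add (lift 1 s) One) (Add (Var 0) One))"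
  let ?s = "lift 1 s"
  have "proves PA [] (inst t ?F)"
  proof (rule induct_rule)
    show "proves PA [] (inst Zero ?F)"
      by (simp add: subst_norm Imp_intro less_zero_elim[of _ s] assum)
    let ?G = "[Lt ?s (Add (Var 0) One), ?F]"
    let ?C = "Lt (Add ?s One) (Add (Add (Var 0) One) One)"
    have "proves PA ?G ?C"
    proof (rule less_succ_elim[of _ ?s "Var 0"])
      show "proves PA (Lt ?s (Var 0) # ?G) ?C"
        by (rule less_succI, rule Imp_elim[of _ _ "Lt ?s (Var 0)"]) (auto intro: assum)
      show "proves PA (Eq ?s (Var 0) # ?G) ?C"
        by (rule Eq_substD[of _ _ ?s "Var 0" _
              "Lt (Add (lift 1 ?s) One) (Add (Add (Var 0) One) One)", OF _ less_succ_self])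
          (auto intro: assum simp: subst_norm)
    qed (auto intro: assum)
    then show "proves PA (?F # map shift [])
        (subst (case_nat (Add (Var 0) One) (\<lambda>i. Var (Suc i))) ?F)"
      by (auto intro!: Imp_intro simp: subst_norm)
  qed
  then have "proves PA [] (Imp (Lt s t) (Lt (Add s One) (Add t One)))" by (simp add: subst_norm)
  then have "proves PA \<Gamma> (Imp (Lt s t) (Lt (Add s One) (Add t One)))" by (rule weaken) simp
  then show ?thesis using assms by (rule Imp_elim)
qed

lemma zero_less_succ: "proves PA \<Gamma> (Lt Zero (Add t One))"
proof -
  have "proves PA \<Gamma> (inst t (Lt Zero (Add (Var 0) One)))"
    by (rule induct_rule) (auto simp: subst_norm intro!: less_succ_self less_succI[OF assum])
  then show ?thesis by (simp add: subst_norm)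
qed

text \<open>Induction on \<open>t\<close> spares a proof that the order is linear:
  \<open>s + 1\<close> lies above \<open>s\<close> and zero, and adding one to a bound for
  \<open>s\<close> and \<open>t\<close> gives a bound for \<open>s\<close> and
  \<open>t + 1\<close>.\<close>

lemma common_upper_bound:
  "proves PA \<Gamma> (Exists (Conj (Lt (lift 1 s) (Var 0)) (Lt (lift 1 t) (Var 0))))"
proof -
  \<comment> \<open>In \<open>?B\<close>, \<open>Var 0\<close> is the upper bound and
    \<open>Var 1\<close> the induction variable, so \<open>s\<close> is read below two
    variables.\<close>
  let ?s = "lift 2 s"
  let ?B = "Conj (Lt ?s (Var 0)) (Lt (Var 1) (Var 0))"
  have "proves PA \<Gamma> (inst t (Exists ?B))"
  proof (rule induct_rule)
    show "proves PA \<Gamma> (inst Zero (Exists ?B))"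
      by (auto simp: subst_norm intro!: Exists_intro[where t = "Add s One"] Conj_intro
          intro: less_succ_self zero_less_succ)
    let ?C = "Exists (Conj (Lt ?s (Var 0)) (Lt (Add (Var 1) One) (Var 0)))"
    have "proves PA (?B # map shift (Exists ?B # map shift \<Gamma>)) (shift ?C)" (is "proves _ ?G _")
    proof -
      have "proves PA ?G ?B" by (rule assum) simp
      from Conj_intro[OF less_succI[OF Conj_elim1[OF this]] succ_mono[OF Conj_elim2[OF this]]]
      have "proves PA ?G
          (Conj (Lt ?s (Add (Var 0) One)) (Lt (Add (Var 1) One) (Add (Var 0) One)))" .
      then show ?thesis
        by (auto simp: subst_norm intro!: Exists_intro[where t = "Add (Var 0) One"])
    qed
    then have "proves PA (Exists ?B # map shift \<Gamma>) ?C"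
      by (rule Exists_elim[OF assum, rotated]) simp
    moreover have "subst (case_nat (Add (Var 0) One) (\<lambda>i. Var (Suc i))) (Exists ?B) = ?C"
      by (simp add: subst_norm)
    ultimately show "proves PA (Exists ?B # map shift \<Gamma>)
        (subst (case_nat (Add (Var 0) One) (\<lambda>i. Var (Suc i))) (Exists ?B))"
      by (simp only:)
  qed
  then show ?thesis by (simp add: subst_norm)
qed

section \<open>Collection and formulas equivalent to \<open>\<Sigma>\<^sub>1\<close>-formulas\<close>

lemma PA_equiv_iff: "PA_equiv F G \<longleftrightarrow> proves PA [F] G \<and> proves PA [G] F"
proof
  assume "PA_equiv F G"
  then have E: "proves PA \<Gamma> (Iff F G)" for \<Gamma>
    unfolding PA_equiv_def by (rule weaken) simp
  show "proves PA [F] G \<and> proves PA [G] F"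
    by (intro conjI Imp_elim[OF Conj_elim1[OF E] assum] Imp_elim[OF Conj_elim2[OF E] assum]) simp_all
qed (auto simp: PA_equiv_def intro: Conj_intro Imp_intro)

lemma PA_equiv_trans: "PA_equiv F G \<Longrightarrow> PA_equiv G H \<Longrightarrow> PA_equiv F H"
  by (meson PA_equiv_iff cut1)

section \<open>Entailment from a single hypothesis\<close>

lemma Exists_left:
  assumes "proves T [F] (shift G)"
  shows "proves T [Exists F] G"
  by (rule Exists_elim[OF assum weaken[OF assms]]) auto

lemma Exists_introV: "proves T \<Gamma> F \<Longrightarrow> proves T \<Gamma> (shift (Exists F))"
  by (simp add: subst_norm) (rule Exists_introD[where t = "Var 0"], auto simp: subst_norm)

lemma Conj_mono:
  assumes "proves T [F] F'" "proves T [G] G'"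
  shows "proves T [Conj F G] (Conj F' G')"
proof -
  have "proves T [Conj F G] (Conj F G)" by (rule assum) simp
  then show ?thesis using assms by (metis Conj_intro Conj_elim1 Conj_elim2 cut1)
qed

lemma Disj_left:
  assumes "proves T [F] H" "proves T [G] H"
  shows "proves T [Disj F G] H"
  by (rule Disj_elim[OF assum weaken[OF assms(1)] weaken[OF assms(2)]]) auto

lemma BEx_left:
  assumes "proves T [F] (shift G)"
  shows "proves T [BEx t F] G"
  by (rule BEx_elim[OF assum weaken[OF assms]]) auto

lemma Disj_mono:
  assumes "proves T [F] F'" "proves T [G] G'"
  shows "proves T [Disj F G] (Disj F' G')"
  by (intro Disj_left Disj_intro1[OF assms(1)] Disj_intro2[OF assms(2)])

lemma Exists_mono: "proves T [F] G \<Longrightarrow> proves T [Exists F] (Exists G)"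
  by (intro Exists_left Exists_introV)

lemma BAll_mono:
  assumes "proves T [F] G"
  shows "proves T [BAll t F] (BAll t G)"
proof (rule BAll_intro, rule cut1[OF assms])
  let ?\<Gamma> = "Lt (Var 0) (lift 1 t) # map shift [BAll t F]"
  have "proves T ?\<Gamma> (BAll (lift 1 t) (subst (up (\<lambda>i. Var (Suc i))) F))"
    by (rule assum) (simp add: shift_def subst_BAll lift_def)
  \<comment> \<open>Instantiating the shifted hypothesis at the variable just introduced returns
    \<open>F\<close> itself.\<close>
  from BAll_elim[OF this assum, of "Var 0"] show "proves T ?\<Gamma> F"
    by (simp add: subst_norm)
qed

lemma PA_equiv_cong:
  assumes "PA_equiv F F'"
  shows "PA_equiv G G' \<Longrightarrow> PA_equiv (Conj F G) (Conj F' G')"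
    and "PA_equiv G G' \<Longrightarrow> PA_equiv (Disj F G) (Disj F' G')"
    and "PA_equiv (Exists F) (Exists F')"
    and "PA_equiv (BAll t F) (BAll t F')"
  using assms by (simp_all add: PA_equiv_iff Conj_mono Disj_mono Exists_mono BAll_mono)

section \<open>Closure properties of the formulas equivalent to
  \<open>\<Sigma>\<^sub>1\<close>-formulas\<close>

definition sigma1_equiv :: "fm \<Rightarrow> bool" where
  "sigma1_equiv F \<longleftrightarrow> (\<exists>G. sigma1 G \<and> PA_equiv F G)"

lemma sigma1_equivI: "delta0 G \<Longrightarrow> PA_equiv F (Exists G) \<Longrightarrow> sigma1_equiv F"
  unfolding sigma1_equiv_def sigma1_def by blast

lemma sigma1_equivE:
  assumes "sigma1_equiv F"
  obtains G where "delta0 G" "PA_equiv F (Exists G)"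
  using assms unfolding sigma1_equiv_def sigma1_def by blast

lemma sigma1_equiv_cong: "PA_equiv F G \<Longrightarrow> sigma1_equiv G \<Longrightarrow> sigma1_equiv F"
  by (meson PA_equiv_trans sigma1_equiv_def)

text \<open>Prefix a vacuous existential quantifier.\<close>

lemma sigma1_equiv_delta0:
  assumes "delta0 F"
  shows "sigma1_equiv F"
proof (rule sigma1_equivI)
  show "delta0 (shift F)" unfolding shift_def using assms by (rule delta0_subst)
  have "proves PA [F] (Exists (shift F))"
    by (rule Exists_introD[OF assum, of F]) (auto simp: subst_norm)
  moreover have "proves PA [Exists (shift F)] F"
    by (intro Exists_left assum) simp
  ultimately show "PA_equiv F (Exists (shift F))" by (simp add: PA_equiv_iff)
qed

lemma sigma1_equiv_Exists_Exists:
  assumes "delta0 F"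
  shows "sigma1_equiv (Exists (Exists F))"
proof (rule sigma1_equivI)
  \<comment> \<open>\<open>x\<close> and \<open>y\<close> replace the outer and the inner bound
    variable, and \<open>k\<close> counts the variables above the parameters. In \<open>?G\<close>
    the unbounded quantifier ranges over the common bound.\<close>
  let ?F = "\<lambda>x y k. subst (case_nat y (case_nat x (\<lambda>n. Var (n + k)))) F"
  let ?G = "BEx (Var 0) (BEx (Var 1) (?F (Var 1) (Var 0) 3))"
  show "delta0 ?G" by (intro delta0.intros delta0_subst assms)
  have "proves PA [F] (shift (shift (Exists ?G)))"
  proof (rule Exists_elim[OF common_upper_bound[of _ "Var 1" "Var 0"]])
    let ?H = "Conj (Lt (lift 1 (Var 1)) (Var 0)) (Lt (lift 1 (Var 0)) (Var 0))"
    let ?\<Gamma> = "?H # map shift [F]"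
    have H: "proves PA ?\<Gamma> ?H" by (rule assum) simp
    \<comment> \<open>The new bound is \<open>Var 0\<close>, which moves the two witnesses to
      \<open>Var 2\<close> and \<open>Var 1\<close>.\<close>
    have "proves PA ?\<Gamma> (?F (Var 2) (Var 1) 3)"
      by (rule assum) (simp add: subst_norm)
    then show "proves PA ?\<Gamma> (shift (shift (shift (Exists ?G))))"
      using Conj_elim1[OF H] Conj_elim2[OF H]
      by (simp add: subst_norm subst_BEx, intro Exists_intro[where t = "Var 0"],
          simp add: subst_norm subst_BEx, intro BEx_intro[where s = "Var 2"],
          simp_all add: subst_norm subst_BEx, intro BEx_intro[where s = "Var 1"],
          simp_all add: subst_norm)
  qed
  then have "proves PA [Exists (Exists F)] (Exists ?G)"
    by (intro Exists_left)
  moreover have "proves PA [?F (Var 1) (Var 0) 3] (shift (shift (shift (Exists (Exists F)))))"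
    by (simp add: subst_norm, rule Exists_intro[where t = "Var 1"], simp add: subst_norm,
        rule Exists_intro[where t = "Var 0"], simp add: subst_norm assum)
  then have "proves PA [Exists ?G] (Exists (Exists F))"
    by (intro Exists_left BEx_left)
  ultimately show "PA_equiv (Exists (Exists F)) (Exists ?G)" by (simp add: PA_equiv_iff)
qed

lemma sigma1_equiv_Exists: "sigma1_equiv F \<Longrightarrow> sigma1_equiv (Exists F)"
  by (metis sigma1_equivE sigma1_equiv_cong PA_equiv_cong(3) sigma1_equiv_Exists_Exists)

text \<open>Both quantifiers are pulled to the front, the witness of \<open>A\<close> as the inner
  variable and that of \<open>B\<close> as the outer one, and then merged.\<close>

lemma sigma1_equiv_Conj:
  assumes "sigma1_equiv F" "sigma1_equiv G"
  shows "sigma1_equiv (Conj F G)"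
proof -
  from assms obtain A B where A: "delta0 A" "PA_equiv F (Exists A)"
    and B: "delta0 B" "PA_equiv G (Exists B)"
    by (meson sigma1_equivE)
  let ?A = "subst (case_nat (Var 0) (\<lambda>n. Var (n + 2))) A"
  let ?B = "subst (case_nat (Var 1) (\<lambda>n. Var (n + 2))) B"
  let ?C = "Conj (Exists A) (Exists B)" and ?D = "Conj ?A ?B"
  have "proves PA [?C] (Exists (Exists ?D))"
  proof (rule Exists_elim[of _ _ B])
    show "proves PA [?C] (Exists B)"
      by (rule Conj_elim2[OF assum]) simp
    let ?\<Gamma> = "B # map shift [?C]"
    show "proves PA ?\<Gamma> (shift (Exists (Exists ?D)))"
    proof (rule Exists_elim)
      show "proves PA ?\<Gamma> (Exists (subst (up (\<lambda>i. Var (Suc i))) A))"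
        by (rule Conj_elim1[of _ _ _ "shift (Exists B)"], rule assum) (simp add: shift_def)
      show "proves PA (subst (up (\<lambda>i. Var (Suc i))) A # map shift ?\<Gamma>)
          (shift (shift (Exists (Exists ?D))))"
        by (simp add: subst_norm, rule Exists_intro[where t = "Var 1"], simp add: subst_norm,
            rule Exists_intro[where t = "Var 0"], simp add: subst_norm assum Conj_intro)
    qed
  qed
  moreover have D: "proves PA [?D] ?A" "proves PA [?D] ?B"
    by (rule Conj_elim1[OF assum] Conj_elim2[OF assum], simp)+
  have "proves PA [?D] (shift (shift (Exists A)))"
    by (simp add: subst_norm, rule Exists_intro[where t = "Var 0"])
      (use D(1) in \<open>simp add: subst_norm\<close>)
  moreover have "proves PA [?D] (shift (shift (Exists B)))"
    by (simp add: subst_norm, rule Exists_intro[where t = "Var 1"])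
      (use D(2) in \<open>simp add: subst_norm\<close>)
  ultimately have "PA_equiv ?C (Exists (Exists ?D))"
    unfolding PA_equiv_iff by (intro conjI Conj_intro Exists_left)
  moreover have "sigma1_equiv (Exists (Exists ?D))"
    by (intro sigma1_equiv_Exists_Exists delta0.intros delta0_subst A B)
  ultimately show ?thesis
    using PA_equiv_cong(1)[OF A(2) B(2)] by (meson sigma1_equiv_cong)
qed

text \<open>The existential quantifier distributes over disjunction, so one witness suffices and
  nothing has to be merged.\<close>

lemma sigma1_equiv_Disj:
  assumes "sigma1_equiv F" "sigma1_equiv G"
  shows "sigma1_equiv (Disj F G)"
proof -
  from assms obtain A B where A: "delta0 A" "PA_equiv F (Exists A)"
    and B: "delta0 B" "PA_equiv G (Exists B)"
    by (meson sigma1_equivE)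
  have "proves PA [Disj (Exists A) (Exists B)] (Exists (Disj A B))"
    by (intro Disj_left Exists_mono) (simp_all add: assum Disj_intro1 Disj_intro2)
  moreover have "proves PA [Exists (Disj A B)] (Disj (Exists A) (Exists B))"
  proof (intro Exists_left Disj_left)
    have "proves PA [A] (shift (Exists A))" "proves PA [B] (shift (Exists B))"
      by (intro Exists_introV assum, simp)+
    then show "proves PA [A] (shift (Disj (Exists A) (Exists B)))"
      "proves PA [B] (shift (Disj (Exists A) (Exists B)))"
      by (simp_all add: shift_def Disj_intro1 Disj_intro2)
  qed
  ultimately have "PA_equiv (Disj (Exists A) (Exists B)) (Exists (Disj A B))"
    by (simp add: PA_equiv_iff)
  with PA_equiv_cong(2)[OF A(2) B(2)] have "PA_equiv (Disj F G) (Exists (Disj A B))"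
    by (rule PA_equiv_trans)
  then show ?thesis by (rule sigma1_equivI[rotated]) (intro delta0.intros A B)
qed

text \<open>Induction on \<open>t\<close>: a bound for the indices below \<open>i\<close> and a
  witness for index \<open>i\<close> have a common upper bound, which serves all indices below
  \<open>i + 1\<close>.\<close>

lemma collection:
  "proves PA [BAll t (Exists F)]
     (Exists (BAll (lift 1 t)
       (BEx (Var 1) (subst (case_nat (Var 0) (case_nat (Var 1) (\<lambda>n. Var (n + 3)))) F))))"
proof -
  \<comment> \<open>In \<open>?F u j k\<close>, \<open>k\<close> is the number of bound variables in whose scope the parameters of \<open>F\<close> stand.
    In \<open>?C\<close>, the induction variable \<open>Var 0\<close> is the bound of the universal quantifier.\<close>
  let ?F = "\<lambda>u j k. subst (case_nat u (case_nat j (\<lambda>n. Var (n + k)))) F"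
  let ?P = "\<lambda>t k. BAll t (Exists (?F (Var 0) (Var 1) (k + 2)))"
  let ?Q = "\<lambda>t b k. BAll t (BEx (lift 1 b) (?F (Var 0) (Var 1) (k + 2)))"
  let ?C = "Imp (?P (Var 0) 1) (Exists (?Q (Var 1) (Var 0) 2))"
  let ?i1 = "Add (Var 0) One"
  \<comment> \<open>Here \<open>Var 0\<close> is the new bound, above the old bound \<open>Var 1\<close> and the witness \<open>Var 2\<close> for the last
    index \<open>Var 3\<close>.\<close>
  have step: "proves PA [Conj (Lt (Var 1) (Var 0)) (Lt (Var 2) (Var 0)), ?Q (Var 3) (Var 1) 4,
      ?F (Var 2) (Var 3) 4] (?Q (Add (Var 3) One) (Var 0) 4)" (is "proves _ ?\<Gamma> _")
  proof (rule BAll_intro, rule less_succ_elim[of _ "Var 0" "Var 4"])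
    let ?\<Delta> = "Lt (Var 0) (lift 1 (Add (Var 3) One)) # map shift ?\<Gamma>"
    let ?G = "BEx (lift 1 (Var 0)) (?F (Var 0) (Var 1) (4 + 2))"
    show "proves PA ?\<Delta> (Lt (Var 0) (Add (Var 4) One))"
      by (rule assum) (simp add: subst_norm)
    let ?\<Delta>1 = "Lt (Var 0) (Var 4) # ?\<Delta>"
    have "proves PA ?\<Delta>1 (BAll (Var 4) (BEx (Var 3) (?F (Var 0) (Var 1) 7)))"
      by (rule assum) (simp add: subst_norm subst_BAll subst_BEx)
    from BAll_elim[OF this assum, of "Var 0"]
    have "proves PA ?\<Delta>1 (BEx (Var 2) (?F (Var 0) (Var 1) 6))"
      by (simp add: subst_norm subst_BEx)
    then show "proves PA ?\<Delta>1 ?G"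
    proof (rule BEx_elim)
      let ?\<Delta>2 = "?F (Var 0) (Var 1) 6 # Lt (Var 0) (lift 1 (Var 2)) # map shift ?\<Delta>1"
      \<comment> \<open>An earlier index keeps its witness \<open>Var 0\<close>: it lies below the
        old bound \<open>Var 3\<close>, hence below the new bound \<open>Var 2\<close>.\<close>
      have L: "proves PA ?\<Delta>2 (Conj (Lt (Var 3) (Var 2)) (Lt (Var 4) (Var 2)))"
        by (rule assum) (simp add: subst_norm)
      have "proves PA ?\<Delta>2 (Lt (Var 0) (Var 3))"
        by (rule assum) (simp add: subst_norm)
      from less_trans[OF this Conj_elim1[OF L]]
      have "proves PA ?\<Delta>2 (BEx (Var 2) (?F (Var 0) (Var 2) 7))"
        by (rule BEx_intro) (simp add: subst_norm assum)
      then show "proves PA ?\<Delta>2 (shift ?G)"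
        by (simp add: subst_norm subst_BEx)
    qed
    let ?\<Delta>3 = "Eq (Var 0) (Var 4) # ?\<Delta>"
    \<comment> \<open>The last index uses the witness kept in the context, now \<open>Var 3\<close>;
      the equation turns the index \<open>Var 4\<close> into \<open>Var 0\<close>.\<close>
    have L: "proves PA ?\<Delta>3 (Conj (Lt (Var 2) (Var 1)) (Lt (Var 3) (Var 1)))"
      by (rule assum) (simp add: subst_norm)
    have E: "proves PA ?\<Delta>3 (Eq (Var 4) (Var 0))"
      by (rule Eq_sym, rule assum) simp
    have "proves PA ?\<Delta>3 (?F (Var 3) (Var 4) 5)"
      by (rule assum) (simp add: subst_norm)
    from Eq_substD[OF E this, of "?F (Var 4) (Var 0) 6"]
    have "proves PA ?\<Delta>3 (?F (Var 3) (Var 0) 5)"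
      by (simp add: subst_norm)
    with Conj_elim2[OF L] show "proves PA ?\<Delta>3 ?G"
      by (intro BEx_intro[where s = "Var 3"]) (simp_all add: subst_norm)
  qed
  have "proves PA [] (inst t ?C)"
  proof (rule induct_rule)
    show "proves PA [] (inst Zero ?C)"
    proof -
      \<comment> \<open>The range of indices is empty, so \<open>Zero\<close> can serve as the
        bound.\<close>
      have "proves PA \<Gamma> (?Q Zero Zero 0)" for \<Gamma>
        by (rule BAll_intro, rule less_zero_elim[of _ "Var 0"], rule assum) (simp add: subst_norm)
      then show ?thesis
        by (simp add: subst_norm subst_BAll subst_BEx, intro Imp_intro Exists_intro[where t = Zero])
          (simp add: subst_norm subst_BAll subst_BEx)
    qed
    let ?\<Gamma> = "[?P ?i1 1, ?C]"
    have P: "proves PA ?\<Gamma> (?P ?i1 1)" by (rule assum) simp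
    have "proves PA ?\<Gamma> (?P (Var 0) 1)"
    proof (rule BAll_intro)
      let ?\<Delta> = "Lt (Var 0) (lift 1 (Var 0)) # map shift ?\<Gamma>"
      have "proves PA ?\<Delta> (shift (?P ?i1 1))" by (rule assum) simp
      then have "proves PA ?\<Delta> (BAll (Add (Var 1) One) (Exists (?F (Var 0) (Var 1) 4)))"
        by (simp add: subst_norm subst_BAll)
      from BAll_elim[OF this less_succI, of "Var 0"]
      show "proves PA ?\<Delta> (Exists (?F (Var 0) (Var 1) (1 + 2)))"
        by (simp add: subst_norm assum)
    qed
    moreover have "proves PA ?\<Gamma> ?C" by (rule assum) simp
    ultimately have Q: "proves PA ?\<Gamma> (Exists (?Q (Var 1) (Var 0) 2))"
      by (rule Imp_elim[rotated])
    \<comment> \<open>The hypothesis at the last index, which the induction hypothesis does not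
      cover.\<close>
    from BAll_elim[OF P less_succ_self]
    have U: "proves PA ?\<Gamma> (Exists (?F (Var 0) (Var 1) 2))"
      by (simp add: subst_norm)
    let ?U = "Exists (?F (Var 0) (Var 1) 2)" and ?V = "Exists (?Q (Var 1) (Var 0) 2)"
    let ?G = "Exists (?Q (Add (Var 1) One) (Var 0) 2)"
    \<comment> \<open>Opening first the witness, then the old bound, then the common upper bound
      produces the variable numbering of \<open>step\<close>.\<close>
    have "proves PA [?U, ?V] ?G"
    proof (rule Exists_elim[OF assum])
      show "?U \<in> set [?U, ?V]" by simp
      let ?\<Gamma>1 = "?F (Var 0) (Var 1) 2 # map shift [?U, ?V]"
      show "proves PA ?\<Gamma>1 (shift ?G)"
      proof (rule Exists_elim[OF assum])
        show "Exists (?Q (Var 2) (Var 0) 3) \<in> set ?\<Gamma>1"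
          by (simp add: subst_norm subst_BAll subst_BEx)
        let ?\<Gamma>2 = "?Q (Var 2) (Var 0) 3 # map shift ?\<Gamma>1"
        show "proves PA ?\<Gamma>2 (shift (shift ?G))"
        proof (rule Exists_elim[OF common_upper_bound[of _ "Var 0" "Var 1"]])
          let ?L = "Conj (Lt (lift 1 (Var 0)) (Var 0)) (Lt (lift 1 (Var 1)) (Var 0))"
          have "proves PA (?L # map shift ?\<Gamma>2) (?Q (Add (Var 3) One) (Var 0) 4)"
            by (rule weaken[OF step]) (simp add: subst_norm subst_BAll subst_BEx)
          then show "proves PA (?L # map shift ?\<Gamma>2) (shift (shift (shift ?G)))"
            by (simp add: subst_norm subst_BAll subst_BEx, intro Exists_intro[where t = "Var 0"])
              (simp add: subst_norm subst_BAll subst_BEx)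
        qed
      qed
    qed
    then have "proves PA ?\<Gamma> ?G"
      by (intro cut[OF U cut[OF weaken[OF Q]]], simp_all add: subset_insertI, elim weaken) auto
    then show "proves PA (?C # map shift []) (subst (case_nat ?i1 (\<lambda>i. Var (Suc i))) ?C)"
      by (simp add: subst_norm subst_BAll subst_BEx Imp_intro)
  qed
  then have "proves PA [BAll t (Exists F)] (inst t ?C)"
    by (rule weaken) simp
  moreover have "inst t ?C = Imp (BAll t (Exists F)) (Exists (BAll (lift 1 t)
      (BEx (Var 1) (?F (Var 0) (Var 1) 3))))"
    by (simp add: subst_norm subst_BAll subst_BEx)
  ultimately show ?thesis
    using Imp_elim[OF _ assum] by auto
qed

text \<open>Collection gives one direction; the converse forgets the bound on the witnesses.\<close>

lemma sigma1_equiv_BAll: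
  assumes "sigma1_equiv F"
  shows "sigma1_equiv (BAll t F)"
proof -
  from assms obtain A where A: "delta0 A" "PA_equiv F (Exists A)"
    by (auto elim: sigma1_equivE)
  let ?A = "subst (case_nat (Var 0) (case_nat (Var 1) (\<lambda>n. Var (n + 3)))) A"
  let ?B = "BAll (lift 1 t) (BEx (Var 1) ?A)"
  have "proves PA [?A] (shift (subst (up (\<lambda>i. Var (Suc i))) (Exists A)))"
    by (simp add: subst_norm, rule Exists_intro[where t = "Var 0"])
      (simp add: subst_norm assum)
  then have "proves PA [?B] (BAll (lift 1 t) (subst (up (\<lambda>i. Var (Suc i))) (Exists A)))"
    by (intro BAll_mono BEx_left)
  then have "proves PA [?B] (shift (BAll t (Exists A)))"
    by (simp add: shift_def subst_BAll lift_def)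
  then have "proves PA [Exists ?B] (BAll t (Exists A))" by (rule Exists_left)
  then have "PA_equiv (BAll t (Exists A)) (Exists ?B)"
    using collection by (simp add: PA_equiv_iff)
  with PA_equiv_cong(4)[OF A(2)] have "PA_equiv (BAll t F) (Exists ?B)"
    by (rule PA_equiv_trans)
  then show ?thesis by (rule sigma1_equivI[rotated]) (intro delta0.intros delta0_subst A)
qed


section \<open>The formulas of while-programs\<close>

lemma delta0_pair_fm: "delta0 (pair_fm x y z)"
  by (auto simp: pair_fm_def Let_def intro!: delta0.intros)

lemma delta0_tuple_fm: "delta0 (tuple_fm xs z)"
  by (induction xs z rule: tuple_fm.induct) (auto intro!: delta0.intros delta0_pair_fm)

lemma delta0_seq_fm: "delta0 (seq_fm w i xs)"
  by (auto simp: seq_fm_def beta_fm_def Let_def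
      intro!: delta0.intros delta0_pair_fm delta0_tuple_fm)

lemma delta0_bexp_fm: "delta0 (bexp_fm xs ts B)"
  by (induction B) (auto intro!: delta0.intros)

lemma delta0_conjs: "delta0 F \<Longrightarrow> \<forall>G\<in>set Gs. delta0 G \<Longrightarrow> delta0 (conjs F Gs)"
  by (induction Gs arbitrary: F) (auto intro: delta0.intros)

lemma sigma1_equiv_exs: "sigma1_equiv F \<Longrightarrow> sigma1_equiv (exs k F)"
  by (induction k) (auto simp: exs_def intro: sigma1_equiv_Exists)

text \<open>The only universal quantifier, the one over \<open>j\<close>, is bounded;
  \<open>w\<close> and the vectors passed to \<open>step\<close> are quantified
  existentially.\<close>

lemma sigma1_equiv_iter_fm:
  "(\<And>ps qs. sigma1_equiv (step ps qs)) \<Longrightarrow> sigma1_equiv (iter_fm n step i ts us)"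
  unfolding iter_fm_def Let_def
  by (intro sigma1_equiv_Exists sigma1_equiv_Conj sigma1_equiv_BAll sigma1_equiv_exs
      sigma1_equiv_delta0[OF delta0_seq_fm])

lemma sigma1_equiv_alpha_fm: "sigma1_equiv (alpha_fm xs S ts us)"
\<comment> \<open>The argument vectors vary because sequencing and loops apply the subprograms to
  fresh intermediate vectors.\<close>
proof (induction S arbitrary: ts us)
  case (Assign x E)
  show ?case
    by (auto intro!: sigma1_equiv_delta0 delta0_conjs delta0.intros)
next
  case (Seq S1 S2)
  then show ?case
    by (simp add: Let_def sigma1_equiv_exs sigma1_equiv_Conj)
next
  case (Cond B S1 S2)
  then show ?case
    by (simp add: sigma1_equiv_Disj sigma1_equiv_Conj sigma1_equiv_delta0 delta0_bexp_fm
        delta0.intros(3))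
next
  case (While B S)
  then show ?case
    by (simp add: sigma1_equiv_Exists sigma1_equiv_iter_fm sigma1_equiv_Conj sigma1_equiv_delta0
        delta0_bexp_fm delta0.intros(3))
qed

lemma sigma1_equiv_phi_fm: "sigma1_equiv (phi_fm xs S ts i us)"
  unfolding phi_fm_def by (intro sigma1_equiv_iter_fm sigma1_equiv_alpha_fm)

theorem proposition4p1p2:
  fixes S :: prog and xs :: "nat list"
  assumes "distinct xs" and "set xs = prog_vars S"
  shows "(\<forall>ys. length ys = length xs \<and> distinct (xs @ ys) \<longrightarrow>
            (\<exists>F. sigma1 F \<and> PA_equiv (alpha_fm xs S (map Var xs) (map Var ys)) F)) \<and>
         (\<forall>y zs. length zs = length xs \<and> distinct (xs @ y # zs) \<longrightarrow>
            (\<exists>F. sigma1 F \<and> PA_equiv (phi_fm xs S (map Var xs) (Var y) (map Var zs)) F))"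
  using sigma1_equiv_alpha_fm sigma1_equiv_phi_fm unfolding sigma1_equiv_def by blast

end
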